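(* Let $L$ be a Tonelli Lagrangian on $\mathbb T^d$. For every mesh size $h>0$ and every time step $\tau>0$, $$\bar L(h,\tau)=\min_{\mu\in\mathcal H_{h,\tau}}\ \sum_{i,j,\ell}L\Big(x_i,\frac{x_j+\ell-x_i}{\tau}\Big)\mu_{ij}^{\ell}.$$
   Context: $\mathbb T^d=\mathbb R^d/\mathbb Z^d$. $H\in C^2(\mathbb T^d\times\mathbb R^d)$ is a Tonelli Hamiltonian: $D^2_{pp}H(x,p)>0$ everywhere and $H$ is superlinear in $p$. The Tonelli Lagrangian is $L(x,v)=\sup_{p\in\mathbb R^d}\{p\cdot v-H(x,p)\}$; it is of class $C^2$, strictly convex in $v$, and superlinear: for every $K>0$ there is $C(K)\in\mathbb R$ with $L(x,v)\ge K|v|-C(K)$ for all $(x,v)$. Mesh sizes are always of the form $h=1/N$ with $N\ge1$ an integer. The grid is $\mathcal G_h=\{x_i=ih \bmod \mathbb Z^d: i\in\{0,\dots,N-1\}^d\}$, and each grid point is identified with its representative in $[0,1)^d$. The fully-discrete Lax–Oleinik operator acts on $u_h:\mathcal G_h\to\mathbb R$ by $$(T_{h,\tau}u_h)(x_j)=\min_{x_i\in\mathcal G_h,\ \ell\in\mathbb Z^d}\Big\{u_h(x_i)+\tau L\Big(x_i,\frac{x_j+\ell-x_i}{\tau}\Big)\Big\},\qquad x_j\in\mathcal G_h.$$ $\bar L(h,\tau)\in\mathbb R$ is the unique constant for which $T_{h,\tau}u=u+\tau\bar L(h,\tau)$ has a solution $u:\mathcal G_h\to\mathbb R$. $\mathcal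 H_{h,\tau}$ is the set of fully-discrete holonomic probability measures: families $\mu=(\mu_{ij}^\ell)$ indexed by $x_i,x_j\in\mathcal G_h$, $\ell\in\mathbb Z^d$, with $\mu_{ij}^\ell\ge0$, $\sum_{i,j,\ell}\mu_{ij}^\ell=1$ and $\sum_{j,\ell}\mu_{ij}^\ell=\sum_{j,\ell}\mu_{ji}^\ell$ for every $x_i\in\mathcal G_h$. (The sum defining the action is allowed to be $+\infty$.) *)

theory Defs
  imports "HOL-Analysis.Analysis"
begin

definition int_vec :: "int ^ 'n \<Rightarrow> real ^ 'n" where
  "int_vec l = (\<chi> k. real_of_int (l $ k))"

text \<open>Functions on the torus are represented by \<open>\<int>\<^sup>d\<close>-periodic functions on \<open>\<real>\<^sup>d\<close>, where \<open>d = CARD('n)\<close>.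
  The maps \<open>D\<close> and \<open>D2\<close> are the (uniquely determined) first and second Frechet derivatives of \<open>H\<close>
  as a function on \<open>\<real>\<^sup>d \<times> \<real>\<^sup>d\<close>; evaluating \<open>D2\<close> twice at \<open>(0, q)\<close> gives the quadratic form of the
  Hessian in the momentum variable. Superlinearity is uniform in \<open>x\<close>.\<close>

definition tonelli_hamiltonian :: "(real ^ 'n \<Rightarrow> real ^ 'n \<Rightarrow> real) \<Rightarrow> bool" where
  "tonelli_hamiltonian H \<longleftrightarrow>
     (\<forall>x p l. H (x + int_vec l) p = H x p) \<and>
     (\<exists>(D :: (real ^ 'n) \<times> (real ^ 'n) \<Rightarrow> ((real ^ 'n) \<times> (real ^ 'n)) \<Rightarrow>\<^sub>L real)
        (D2 :: (real ^ 'n) \<times> (real ^ 'n) \<Rightarrow>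
           ((real ^ 'n) \<times> (real ^ 'n)) \<Rightarrow>\<^sub>L (((real ^ 'n) \<times> (real ^ 'n)) \<Rightarrow>\<^sub>L real)).
        (\<forall>z. ((\<lambda>(x, p). H x p) has_derivative blinfun_apply (D z)) (at z)) \<and>
        (\<forall>z. (D has_derivative blinfun_apply (D2 z)) (at z)) \<and>
        continuous_on UNIV D2 \<and>
        (\<forall>x p q. q \<noteq> 0 \<longrightarrow> 0 < blinfun_apply (blinfun_apply (D2 (x, p)) (0, q)) (0, q))) \<and>
     (\<forall>K>0. \<exists>C. \<forall>x p. K * norm p - C \<le> H x p)"

text \<open>The supremum is over a set that is bounded above, by superlinearity of \<open>H\<close>.\<close>

definition tonelli_lagrangian :: "(real ^ 'n \<Rightarrow> real ^ 'n \<Rightarrow> real) \<Rightarrow> bool" where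
  "tonelli_lagrangian L \<longleftrightarrow>
     (\<exists>H. tonelli_hamiltonian H \<and> (\<forall>x v. L x v = (SUP p. p \<bullet> v - H x p)))"

definition mesh_size :: "real \<Rightarrow> bool" where
  "mesh_size h \<longleftrightarrow> (\<exists>N::nat. N \<ge> 1 \<and> h = 1 / real N)"

text \<open>Grid points are represented in \<open>[0,1)\<^sup>d\<close>; for \<open>h = 1/N\<close> the constraint on the
  multi-index \<open>i\<close> reads \<open>i k < N\<close>.\<close>

definition grid :: "real \<Rightarrow> (real ^ 'n) set" where
  "grid h = {(\<chi> k. real (i k) * h) | i :: 'n \<Rightarrow> nat. \<forall>k. real (i k) * h < 1}"

definition velocity :: "real \<Rightarrow> real ^ 'n \<Rightarrow> real ^ 'n \<Rightarrow> int ^ 'n \<Rightarrow> real ^ 'n" where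
  "velocity \<tau> x y l = (y + int_vec l - x) /\<^sub>R \<tau>"

text \<open>\<open>LEAST\<close> over the reals denotes the minimum of a set (which exists here,
  \<open>L\<close> being superlinear and the grid finite).\<close>

definition lax_oleinik ::
  "(real ^ 'n \<Rightarrow> real ^ 'n \<Rightarrow> real) \<Rightarrow> real \<Rightarrow> real \<Rightarrow> (real ^ 'n \<Rightarrow> real) \<Rightarrow> real ^ 'n \<Rightarrow> real" where
  "lax_oleinik L h \<tau> u y =
     (LEAST c. \<exists>x\<in>grid h. \<exists>l. c = u x + \<tau> * L x (velocity \<tau> x y l))"

definition effective_lagrangian :: "(real ^ 'n \<Rightarrow> real ^ 'n \<Rightarrow> real) \<Rightarrow> real \<Rightarrow> real \<Rightarrow> real" where
  "effective_lagrangian L h \<tau> =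
     (THE c. \<exists>u. \<forall>y\<in>grid h. lax_oleinik L h \<tau> u y = u y + \<tau> * c)"

text \<open>Only the values of \<open>\<mu>\<close> at grid points matter.\<close>

definition holonomic :: "real \<Rightarrow> (real ^ 'n \<Rightarrow> real ^ 'n \<Rightarrow> int ^ 'n \<Rightarrow> real) set" where
  "holonomic h = {\<mu>.
     (\<forall>x\<in>grid h. \<forall>y\<in>grid h. \<forall>l. 0 \<le> \<mu> x y l) \<and>
     ((\<lambda>(x, y, l). \<mu> x y l) has_sum 1) (grid h \<times> grid h \<times> UNIV) \<and>
     (\<forall>x\<in>grid h. (\<Sum>\<^sub>\<infinity>(y, l)\<in>grid h \<times> UNIV. \<mu> x y l) = (\<Sum>\<^sub>\<infinity>(y, l)\<in>grid h \<times> UNIV. \<mu> y x l))}"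

text \<open>The sum is taken in the extended reals. As \<open>L\<close> is bounded below and \<open>\<mu>\<close> is summable,
  the negative parts are summable, so the sum always exists, with a value in \<open>(-\<infinity>, \<infinity>]\<close>.\<close>

definition action ::
  "(real ^ 'n \<Rightarrow> real ^ 'n \<Rightarrow> real) \<Rightarrow> real \<Rightarrow> real \<Rightarrow>
   (real ^ 'n \<Rightarrow> real ^ 'n \<Rightarrow> int ^ 'n \<Rightarrow> real) \<Rightarrow> ereal" where
  "action L h \<tau> \<mu> =
     (\<Sum>\<^sub>\<infinity>(x, y, l)\<in>grid h \<times> grid h \<times> UNIV. ereal (L x (velocity \<tau> x y l) * \<mu> x y l))"

end

theory Submission imports Defs begin

text \<open>Minimising over \<open>\<ell>\<close> turns the Lax--Oleinik operator into a min-plus matrix on a finite set.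
  If \<open>u\<close> is an additive eigenvector with eigenvalue \<open>\<tau> a\<close>, then integrating
  \<open>u(y) + \<tau> a \<le> u(x) + \<tau> L(x, v)\<close> against a holonomic measure cancels \<open>u\<close> and gives the lower bound \<open>a\<close>
  for the action. Equality holds for the uniform measure on an invariant set of the map sending a grid point
  to an optimal predecessor. The eigenvalue is thus the minimal action, so it is unique. An eigenvector is
  found by Perron's method at the largest \<open>a\<close> admitting a subsolution.\<close>

section \<open>Subsolutions of a min-plus eigenvalue problem\<close>

definition subsolution :: "'a set \<Rightarrow> ('a \<Rightarrow> 'a \<Rightarrow> real) \<Rightarrow> real \<Rightarrow> ('a \<Rightarrow> real) \<Rightarrow> bool" where
  "subsolution S c a u \<longleftrightarrow> (\<forall>x\<in>S. \<forall>y\<in>S. u y + a \<le> u x + c x y)"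

lemma subsolutionD: "subsolution S c a u \<Longrightarrow> x \<in> S \<Longrightarrow> y \<in> S \<Longrightarrow> u y + a \<le> u x + c x y"
  by (simp add: subsolution_def)

lemma subsolution_mono: "subsolution S c a u \<Longrightarrow> b \<le> a \<Longrightarrow> subsolution S c b u"
  unfolding subsolution_def by (meson add_left_mono order_trans)

lemma subsolution_shift: "subsolution S c a u \<Longrightarrow> subsolution S c a (\<lambda>x. u x - k)"
  by (auto simp: subsolution_def)

text \<open>Discrete Mane potential based at \<open>x0\<close>: when a subsolution exists, it is the
  least total cost \<open>c - a\<close> of paths from \<open>x0\<close>, normalised to vanish at
  \<open>x0\<close>.\<close>

definition max_subsolution :: "'a set \<Rightarrow> ('a \<Rightarrow> 'a \<Rightarrow> real) \<Rightarrow> 'a \<Rightarrow> real \<Rightarrow> 'a \<Rightarrow> real" where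
  "max_subsolution S c x0 a y = (SUP u\<in>{u. subsolution S c a u \<and> u x0 = 0}. u y)"

context
  fixes S :: "'a set" and c :: "'a \<Rightarrow> 'a \<Rightarrow> real" and x0 :: 'a
  assumes x0: "x0 \<in> S"
begin

lemma le_max_subsolution:
  assumes "subsolution S c a u" "u x0 = 0" "y \<in> S"
  shows "u y \<le> max_subsolution S c x0 a y"
  unfolding max_subsolution_def
proof (rule cSUP_upper)
  show "bdd_above ((\<lambda>u. u y) ` {u. subsolution S c a u \<and> u x0 = 0})"
    \<comment> \<open>The single step from \<open>x0\<close> to \<open>y\<close> bounds every
      normalised subsolution at \<open>y\<close>.\<close>
    using subsolutionD[OF _ x0 assms(3), of c a]
    by (intro bdd_aboveI[of _ "c x0 y - a"]) force
qed (use assms in auto)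

text \<open>The given \<open>u\<close>, shifted to vanish at \<open>x0\<close>, makes the set under
  the supremum nonempty, so \<open>SUP\<close> is a least upper bound there.\<close>

lemma max_subsolution_le:
  assumes "subsolution S c a u" and "\<And>v. subsolution S c a v \<Longrightarrow> v x0 = 0 \<Longrightarrow> v y \<le> k"
  shows "max_subsolution S c x0 a y \<le> k"
  unfolding max_subsolution_def
  using assms subsolution_shift[OF assms(1), of "u x0"]
  by (intro cSUP_least) auto

lemma max_subsolution_base:
  assumes "subsolution S c a u"
  shows "max_subsolution S c x0 a x0 = 0"
  using le_max_subsolution[OF subsolution_shift[OF assms, of "u x0"] _ x0]
    max_subsolution_le[OF assms, of x0 0] by force

lemma subsolution_max_subsolution:
  assumes "subsolution S c a u"
  shows "subsolution S c a (max_subsolution S c x0 a)"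
  unfolding subsolution_def
proof (intro ballI)
  fix x y assume xy: "x \<in> S" "y \<in> S"
  have "max_subsolution S c x0 a y \<le> max_subsolution S c x0 a x + c x y - a"
  proof (rule max_subsolution_le[OF assms])
    fix v assume v: "subsolution S c a v" "v x0 = 0"
    show "v y \<le> max_subsolution S c x0 a x + c x y - a"
      using subsolutionD[OF v(1) xy] le_max_subsolution[OF v xy(1)] by linarith
  qed
  then show "max_subsolution S c x0 a y + a \<le> max_subsolution S c x0 a x + c x y" by simp
qed

lemma max_subsolution_antimono:
  assumes "subsolution S c b u" "a \<le> b" "y \<in> S"
  shows "max_subsolution S c x0 b y \<le> max_subsolution S c x0 a y"
  by (rule max_subsolution_le[OF assms(1)])
    (use assms le_max_subsolution subsolution_mono in blast)

text \<open>Perron's argument: if every inequality into \<open>y\<close> were strict, raising the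
  value at \<open>y\<close> alone by the smallest gap \<open>e\<close> would give a larger
  subsolution still vanishing at \<open>x0\<close>.\<close>

lemma max_subsolution_solves:
  assumes "finite S" and sub: "subsolution S c a u" and y: "y \<in> S" "y \<noteq> x0"
  defines "w \<equiv> max_subsolution S c x0 a"
  shows "\<exists>x\<in>S. w y + a = w x + c x y"
proof (rule ccontr)
  assume neg: "\<not> ?thesis"
  have w: "subsolution S c a w" "w x0 = 0"
    unfolding w_def using subsolution_max_subsolution[OF sub] max_subsolution_base[OF sub] by auto
  define e where "e = Min ((\<lambda>x. w x + c x y - (w y + a)) ` S)"
  have "e > 0"
    unfolding e_def using assms(1) x0 neg subsolutionD[OF w(1) _ y(1)]
    by (subst Min_gr_iff) (auto simp: less_le)
  have e: "e \<le> w x + c x y - (w y + a)" if "x \<in> S" for x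
    unfolding e_def using assms(1) that by simp
  \<comment> \<open>Inequalities into \<open>y\<close> from another point lose at most the gap
    \<open>e\<close>, those out of \<open>y\<close> gain, and the loop at \<open>y\<close> shifts
    equally on both sides.\<close>
  have "subsolution S c a (w(y := w y + e))"
    unfolding subsolution_def
  proof (intro ballI)
    fix x z assume xz: "x \<in> S" "z \<in> S"
    show "(w(y := w y + e)) z + a \<le> (w(y := w y + e)) x + c x z"
      using subsolutionD[OF w(1) xz] e[OF xz(1)] \<open>e > 0\<close> by auto
  qed
  from le_max_subsolution[OF this _ y(1)] w(2) y(2) \<open>e > 0\<close> show False
    by (simp add: w_def)
qed

end

section \<open>The critical value and an additive eigenvector\<close>

text \<open>The supremum of admissible values is attained because normalised maximal subsolutions
  decrease in \<open>a\<close> and are bounded below; their pointwise infimum inherits the limiting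
  inequality.\<close>

lemma critical_subsolution_exists:
  fixes c :: "'a \<Rightarrow> 'a \<Rightarrow> real"
  assumes "finite S" and "S \<noteq> {}"
  obtains \<kappa> u where "subsolution S c \<kappa> u" "\<And>a v. subsolution S c a v \<Longrightarrow> a \<le> \<kappa>"
proof -
  obtain x0 where x0: "x0 \<in> S" using assms(2) by blast
  define A where "A = {a. \<exists>u. subsolution S c a u}"
  \<comment> \<open>The smallest cost is admissible, with the zero function as subsolution.\<close>
  define a0 where "a0 = Min ((\<lambda>(x, y). c x y) ` (S \<times> S))"
  have "a0 \<le> c x y" if "x \<in> S" "y \<in> S" for x y
    unfolding a0_def using that assms(1) by (auto intro!: Min_le)
  then have a0: "a0 \<in> A" unfolding A_def subsolution_def by (auto intro!: exI[of _ "\<lambda>_. 0"])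
  have bdd: "bdd_above A"
    using subsolutionD[OF _ x0 x0, of c] unfolding A_def by (intro bdd_aboveI[of _ "c x0 x0"]) force
  define \<kappa> where "\<kappa> = Sup A"
  have le: "a \<le> \<kappa>" if "a \<in> A" for a unfolding \<kappa>_def using that bdd by (rule cSup_upper)
  define W where "W a = max_subsolution S c x0 a" for a
  have sub: "subsolution S c a (W a)" "W a x0 = 0" if "a \<in> A" for a
    using that subsolution_max_subsolution[OF x0] max_subsolution_base[OF x0]
    unfolding A_def W_def by auto
  have anti: "W b y \<le> W a y" if "b \<in> A" "a \<le> b" "y \<in> S" for a b y
    unfolding W_def using that max_subsolution_antimono[OF x0] unfolding A_def by auto
  \<comment> \<open>Keeping \<open>a\<close> above \<open>a0\<close> makes the lower bound
    \<open>a0 - c y x0\<close>, from the step \<open>y\<close> to \<open>x0\<close>, uniform in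
    \<open>a\<close>.\<close>
  define A' where "A' = A \<inter> {a0..}"
  have ne: "A' \<noteq> {}" using a0 unfolding A'_def by auto
  define w where "w y = (INF a\<in>A'. W a y)" for y
  have wle: "w y \<le> W a y" if "a \<in> A'" "y \<in> S" for a y
    unfolding w_def
  proof (rule cINF_lower[OF _ that(1)])
    show "bdd_below ((\<lambda>a. W a y) ` A')"
    proof (rule bdd_belowI2[of _ "a0 - c y x0"])
      fix a assume "a \<in> A'"
      then show "a0 - c y x0 \<le> W a y"
        using subsolutionD[OF sub(1) that(2) x0, of a] sub(2)[of a] unfolding A'_def by auto
    qed
  qed
  have "subsolution S c \<kappa> w"
    unfolding subsolution_def
  proof (intro ballI)
    fix x y assume xy: "x \<in> S" "y \<in> S"
    \<comment> \<open>The parameters are decoupled by passing to \<open>max a b\<close>: then the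
      infimum over \<open>b\<close> and the supremum over \<open>a\<close> can be taken
      separately.\<close>
    have *: "w y + a \<le> W b x + c x y" if ab: "a \<in> A" "b \<in> A'" for a b
    proof -
      have m: "max a b \<in> A'" using ab unfolding A'_def by (auto simp: max_def)
      then have "max a b \<in> A" by (simp add: A'_def)
      from subsolutionD[OF sub(1)[OF this] xy] anti[OF this _ xy(1), of b] wle[OF m xy(2)]
      show ?thesis by simp
    qed
    have "w y + a \<le> w x + c x y" if "a \<in> A" for a
    proof -
      have "w y + a - c x y \<le> w x"
        unfolding w_def[of x] by (rule cINF_greatest[OF ne]) (use *[OF that] in force)
      then show ?thesis by simp
    qed
    then have "\<kappa> \<le> w x + c x y - w y"
      unfolding \<kappa>_def using a0 by (intro cSup_least) force+
    then show "w y + \<kappa> \<le> w x + c x y" by simp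
  qed
  then show ?thesis using that le unfolding A_def by blast
qed

text \<open>If no maximal subsolution based at a point \<open>z\<close> were a solution, each would be strict at its base
  point, and their average would be strict everywhere, contradicting the choice of \<open>\<kappa>\<close>.\<close>

lemma additive_eigenvector_exists:
  fixes c :: "'a \<Rightarrow> 'a \<Rightarrow> real"
  assumes fin: "finite S" and ne: "S \<noteq> {}"
  obtains \<kappa> u where "subsolution S c \<kappa> u" "\<And>y. y \<in> S \<Longrightarrow> \<exists>x\<in>S. u y + \<kappa> = u x + c x y"
proof -
  obtain \<kappa> u where u: "subsolution S c \<kappa> u" and max: "\<And>a v. subsolution S c a v \<Longrightarrow> a \<le> \<kappa>"
    using critical_subsolution_exists[OF assms] by metis
  define W where "W z = max_subsolution S c z \<kappa>" for z
  have sub: "subsolution S c \<kappa> (W z)" if "z \<in> S" for z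
    unfolding W_def using subsolution_max_subsolution[OF that u] .
  show ?thesis
  proof (cases "\<exists>z\<in>S. \<exists>x\<in>S. W z z + \<kappa> = W z x + c x z")
    case True
    then obtain z where z: "z \<in> S" "\<exists>x\<in>S. W z z + \<kappa> = W z x + c x z" by blast
    show ?thesis
    proof (rule that[OF sub[OF z(1)]])
      fix y assume "y \<in> S"
      then show "\<exists>x\<in>S. W z y + \<kappa> = W z x + c x y"
        using max_subsolution_solves[OF z(1) fin u] z(2) unfolding W_def by (cases "y = z") auto
    qed
  next
    case False
    define n where "n = real (card S)"
    have n: "n > 0" unfolding n_def using assms by (simp add: card_gt_0_iff)
    define v where "v y = (\<Sum>z\<in>S. W z y) / n" for y
    have strict: "v y + \<kappa> < v x + c x y" if xy: "x \<in> S" "y \<in> S" for x y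
    proof -
      have "(\<Sum>z\<in>S. W z y + \<kappa>) < (\<Sum>z\<in>S. W z x + c x y)"
      proof (rule sum_strict_mono_ex1[OF fin])
        show "\<forall>z\<in>S. W z y + \<kappa> \<le> W z x + c x y" using subsolutionD[OF sub] xy by blast
        show "\<exists>z\<in>S. W z y + \<kappa> < W z x + c x y"
          using False subsolutionD[OF sub] xy by (intro bexI[of _ y]) (force simp: less_le)+
      qed
      then have "(\<Sum>z\<in>S. W z y) + n * \<kappa> < (\<Sum>z\<in>S. W z x) + n * c x y"
        by (simp add: sum.distrib n_def)
      then have "((\<Sum>z\<in>S. W z y) + n * \<kappa>) / n < ((\<Sum>z\<in>S. W z x) + n * c x y) / n"
        using n by (rule divide_strict_right_mono)
      then show ?thesis using n unfolding v_def by (simp add: add_divide_distrib)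
    qed
    \<comment> \<open>Over finitely many pairs the strict gaps have a positive minimum, so \<kappa>
      could be increased by \<open>e\<close>.\<close>
    define e where "e = Min ((\<lambda>(x, y). v x + c x y - (v y + \<kappa>)) ` (S \<times> S))"
    have "e > 0" unfolding e_def using fin ne strict by (subst Min_gr_iff) auto
    have "e \<le> v x + c x y - (v y + \<kappa>)" if "x \<in> S" "y \<in> S" for x y
      unfolding e_def using that fin by (auto intro!: Min_le)
    then have "subsolution S c (\<kappa> + e) v" unfolding subsolution_def by (force simp: algebra_simps)
    from max[OF this] \<open>e > 0\<close> show ?thesis by simp
  qed
qed

section \<open>Finite invariant sets and finite sublevel sets\<close>

text \<open>A nonempty invariant set of least cardinality must equal its own image. It will carry
  the minimising measure.\<close>

lemma finite_endomap_bij_subset: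
  assumes "finite S" "S \<noteq> {}" "f ` S \<subseteq> S"
  obtains A where "A \<subseteq> S" "A \<noteq> {}" "bij_betw f A A"
proof -
  define P where "P A \<longleftrightarrow> A \<subseteq> S \<and> A \<noteq> {} \<and> f ` A \<subseteq> A" for A
  have "P S" using assms by (simp add: P_def)
  then obtain A where A: "P A" and min: "\<And>B. P B \<Longrightarrow> card A \<le> card B"
    using arg_min_nat_lemma[of P S card] by (metis)
  have fA: "finite A" using A assms(1) finite_subset unfolding P_def by blast
  have sub: "f ` A \<subseteq> A" using A unfolding P_def by blast
  have "P (f ` A)" using A unfolding P_def by blast
  then have "f ` A = A" using card_seteq[OF fA sub min] by blast
  then have "bij_betw f A A" using fA by (simp add: bij_betw_def finite_surj_inj)
  then show ?thesis using that A unfolding P_def by blast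
qed

lemma has_min_if_finite_sublevels:
  fixes f :: "'b \<Rightarrow> real"
  assumes "\<And>B. finite {l. f l \<le> B}"
  obtains l where "\<And>k. f l \<le> f k"
proof -
  \<comment> \<open>\<open>undefined\<close> is an arbitrary point that makes the sublevel set
    nonempty; outside that set \<open>f\<close> is larger anyway.\<close>
  let ?A = "{l. f l \<le> f undefined}"
  have ne: "?A \<noteq> {}" by blast
  have "f (arg_min_on f ?A) \<le> f k" if "k \<in> ?A" for k
    using arg_min_least[OF assms ne that] .
  moreover have "f (arg_min_on f ?A) \<le> f undefined"
    using arg_min_if_finite(1)[OF assms ne] by blast
  ultimately have "f (arg_min_on f ?A) \<le> f k" for k
    by (cases "k \<in> ?A") (blast, force)
  then show ?thesis by (rule that)
qed

lemma finite_bounded_int_vec: "finite {l :: int ^ 'n. norm (int_vec l) \<le> B}"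
proof -
  have "finite (PiE UNIV (\<lambda>_ :: 'n. {- \<lceil>B\<rceil>..\<lceil>B\<rceil>}))" by (intro finite_PiE) auto
  moreover have "vec_nth ` {l :: int ^ 'n. norm (int_vec l) \<le> B} \<subseteq> PiE UNIV (\<lambda>_. {- \<lceil>B\<rceil>..\<lceil>B\<rceil>})"
  proof (clarsimp simp: PiE_iff)
    fix l :: "int ^ 'n" and k assume "norm (int_vec l) \<le> B"
    then have "\<bar>real_of_int (l $ k)\<bar> \<le> B"
      using component_le_norm_cart[of "int_vec l" k] by (simp add: int_vec_def)
    then show "- \<lceil>B\<rceil> \<le> l $ k \<and> l $ k \<le> \<lceil>B\<rceil>" by linarith
  qed
  moreover have "inj_on vec_nth {l :: int ^ 'n. norm (int_vec l) \<le> B}"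
    by (auto simp: inj_on_def vec_nth_inject)
  ultimately show ?thesis by (meson finite_imageD finite_subset)
qed

section \<open>Coercivity of the Lagrangian and attained minima\<close>

lemma tonelli_hamiltonian_continuous:
  fixes H :: "real ^ 'n \<Rightarrow> real ^ 'n \<Rightarrow> real"
  assumes "tonelli_hamiltonian H"
  shows "continuous_on A (H x)"
proof -
  obtain D :: "(real ^ 'n) \<times> (real ^ 'n) \<Rightarrow> ((real ^ 'n) \<times> (real ^ 'n)) \<Rightarrow>\<^sub>L real"
    where "\<And>z. ((\<lambda>(x, p). H x p) has_derivative blinfun_apply (D z)) (at z)"
    using assms unfolding tonelli_hamiltonian_def by blast
  then have "continuous_on UNIV (\<lambda>(x, p). H x p)"
    by (intro continuous_at_imp_continuous_on ballI has_derivative_continuous)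
  from continuous_on_compose2[OF this, of A "Pair x"] show ?thesis
    by (simp add: continuous_on_Pair)
qed

text \<open>Testing the supremum with a momentum of norm at most one gives linear growth, since
  \<open>H x\<close> is bounded on the unit ball. The constant may depend on the fixed
  \<open>x\<close>.\<close>

lemma tonelli_lagrangian_coercive:
  fixes L :: "real ^ 'n \<Rightarrow> real ^ 'n \<Rightarrow> real"
  assumes "tonelli_lagrangian L"
  obtains C where "\<And>v. norm v - C \<le> L x v"
proof -
  obtain H where H: "tonelli_hamiltonian H" and L: "\<And>v. L x v = (SUP p. p \<bullet> v - H x p)"
    using assms unfolding tonelli_lagrangian_def by blast
  have "compact (H x ` cball 0 1)"
    using tonelli_hamiltonian_continuous[OF H] by (intro compact_continuous_image) auto
  then have "bdd_above (H x ` cball 0 1)" by (intro bounded_imp_bdd_above compact_imp_bounded)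
  then obtain C where C: "\<And>p. norm p \<le> 1 \<Longrightarrow> H x p \<le> C"
    unfolding bdd_above_def by (metis mem_cball_0 imageI)
  have "norm v - C \<le> L x v" for v
  proof -
    \<comment> \<open>Superlinearity at rate \<open>norm v + 1\<close> dominates
      \<open>p \<bullet> v\<close>, so the supremum is over a bounded set; the summand 1 keeps the
      rate positive at \<open>v = 0\<close>.\<close>
    have "norm v + 1 > 0" by (simp add: add_nonneg_pos)
    then obtain C' where C': "\<And>p. (norm v + 1) * norm p - C' \<le> H x p"
      using H unfolding tonelli_hamiltonian_def by metis
    have bdd: "bdd_above (range (\<lambda>p. p \<bullet> v - H x p))"
    proof (rule bdd_aboveI2)
      fix p
      have "p \<bullet> v \<le> norm v * norm p" using norm_cauchy_schwarz[of p v] by (simp add: mult.commute)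
      then show "p \<bullet> v - H x p \<le> C'" using C'[of p] by (simp add: algebra_simps)
        (smt (verit) norm_ge_zero)
    qed
    have "sgn v \<bullet> v = norm v"
      by (cases "v = 0") (simp_all add: sgn_div_norm power2_norm_eq_inner[symmetric] power2_eq_square)
    moreover have "H x (sgn v) \<le> C" by (rule C) (simp add: norm_sgn)
    ultimately show ?thesis
      using cSUP_upper[OF UNIV_I bdd, of "sgn v"] unfolding L by simp
  qed
  then show ?thesis using that by blast
qed

text \<open>Coercivity confines each sublevel set to integer vectors of bounded norm, hence to
  finitely many.\<close>

lemma lagrangian_min_over_translates:
  fixes L :: "real ^ 'n \<Rightarrow> real ^ 'n \<Rightarrow> real"
  assumes "tonelli_lagrangian L" "\<tau> > 0"
  shows "\<exists>l. \<forall>k. L x (velocity \<tau> x y l) \<le> L x (velocity \<tau> x y k)"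
proof -
  obtain C where C: "\<And>v. norm v - C \<le> L x v" using tonelli_lagrangian_coercive[OF assms(1)] by metis
  have "finite {l. L x (velocity \<tau> x y l) \<le> B}" for B
  proof (rule finite_subset[OF _ finite_bounded_int_vec])
    show "{l. L x (velocity \<tau> x y l) \<le> B} \<subseteq> {l. norm (int_vec l) \<le> \<tau> * (B + C) + norm (y - x)}"
    proof clarify
      fix l assume "L x (velocity \<tau> x y l) \<le> B"
      then have "norm (velocity \<tau> x y l) \<le> B + C" using C[of "velocity \<tau> x y l"] by linarith
      then have "\<tau> * norm (velocity \<tau> x y l) \<le> \<tau> * (B + C)"
        using assms(2) by (intro mult_left_mono) auto
      moreover have "\<tau> * norm (velocity \<tau> x y l) = norm (y + int_vec l - x)"
        using assms(2) by (simp add: velocity_def)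
      ultimately have "norm (y + int_vec l - x) \<le> \<tau> * (B + C)" by simp
      then show "norm (int_vec l) \<le> \<tau> * (B + C) + norm (y - x)"
        using norm_triangle_ineq4[of "y + int_vec l - x" "y - x"] by simp
    qed
  qed
  then show ?thesis using has_min_if_finite_sublevels[of "\<lambda>l. L x (velocity \<tau> x y l)"] by metis
qed

lemma finite_grid:
  assumes "mesh_size h"
  shows "finite (grid h :: (real ^ 'n) set)"
proof -
  obtain N :: nat where N: "N \<ge> 1" "h = 1 / real N" using assms unfolding mesh_size_def by blast
  have "(grid h :: (real ^ 'n) set) \<subseteq> (\<lambda>i. \<chi> k. real (i k) * h) ` PiE UNIV (\<lambda>_. {..<N})"
    using N unfolding grid_def by (auto intro!: imageI)
  then show ?thesis by (rule finite_subset) (auto intro!: finite_PiE)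
qed

lemma grid_nonempty: "grid h \<noteq> {}"
  unfolding grid_def by (auto intro!: exI[of _ "\<lambda>_. 0"])


text \<open>Unfolding \<open>LEAST\<close> from left to right needs an existing minimum. It is found
  in two stages: over translates for each \<open>x\<close>, then over the finite grid.\<close>

lemma lax_oleinik_eq_iff:
  fixes L :: "real ^ 'n \<Rightarrow> real ^ 'n \<Rightarrow> real"
  assumes "tonelli_lagrangian L" "mesh_size h" "\<tau> > 0"
  shows "lax_oleinik L h \<tau> u y = k \<longleftrightarrow>
    (\<exists>x\<in>grid h. \<exists>l. k = u x + \<tau> * L x (velocity \<tau> x y l)) \<and>
    (\<forall>x\<in>grid h. \<forall>l. k \<le> u x + \<tau> * L x (velocity \<tau> x y l))" (is "_ \<longleftrightarrow> ?min k")
proof -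
  obtain l where l: "\<And>x k. L x (velocity \<tau> x y (l x)) \<le> L x (velocity \<tau> x y k)"
    using lagrangian_min_over_translates[OF assms(1,3), of _ y] by metis
  let ?f = "\<lambda>x. u x + \<tau> * L x (velocity \<tau> x y (l x))"
  have fin: "finite (?f ` grid h)" "?f ` grid h \<noteq> {}"
    using finite_grid[OF assms(2)] grid_nonempty by auto
  have "?min (Min (?f ` grid h))"
  proof (intro conjI ballI allI)
    show "\<exists>x\<in>grid h. \<exists>l. Min (?f ` grid h) = u x + \<tau> * L x (velocity \<tau> x y l)"
      using Min_in[OF fin] by blast
    fix x :: "real ^ 'n" and k assume "x \<in> grid h"
    then have "Min (?f ` grid h) \<le> ?f x" using fin(1) by (intro Min_le) auto
    also have "\<dots> \<le> u x + \<tau> * L x (velocity \<tau> x y k)" using l assms(3) by simp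
    finally show "Min (?f ` grid h) \<le> u x + \<tau> * L x (velocity \<tau> x y k)" .
  qed
  then obtain m where m: "?min m" by (rule that)
  have least: "lax_oleinik L h \<tau> u y = k" if "?min k" for k
    unfolding lax_oleinik_def using that by (intro Least_equality) auto
  show ?thesis
  proof
    assume "lax_oleinik L h \<tau> u y = k"
    with least[OF m] have "k = m" by simp
    show "?min k" unfolding \<open>k = m\<close> by (rule m)
  qed (rule least)
qed

section \<open>Integration against holonomic measures\<close>

lemma has_sum_Times_finite:
  fixes f :: "'a \<Rightarrow> 'b \<Rightarrow> 'c :: topological_comm_monoid_add"
  assumes "finite A" "\<And>x. x \<in> A \<Longrightarrow> (f x has_sum g x) B"
  shows "((\<lambda>(x, y). f x y) has_sum sum g A) (A \<times> B)"
  using assms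
proof (induction A)
  case (insert a A)
  have "((\<lambda>(x, y). f x y) has_sum g a) (Pair a ` B)"
    using insert.prems by (subst has_sum_reindex) (auto simp: inj_on_def o_def)
  then have "((\<lambda>(x, y). f x y) has_sum g a + sum g A) (Pair a ` B \<union> A \<times> B)"
    using insert by (intro has_sum_Un_disjoint) auto
  moreover have "Pair a ` B \<union> A \<times> B = insert a A \<times> B" by auto
  ultimately show ?case using insert.hyps by simp
qed simp

text \<open>Holonomy says that source and target marginals agree, so \<open>w x\<close> and
  \<open>w y\<close> have the same integral, namely the sum of \<open>w x * r x\<close>.\<close>

lemma has_sum_potential_difference:
  fixes \<mu> :: "real ^ 'n \<Rightarrow> real ^ 'n \<Rightarrow> int ^ 'n \<Rightarrow> real"
  assumes "mesh_size h" "\<mu> \<in> holonomic h"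
  shows "((\<lambda>(x, y, l). (w y - w x) * \<mu> x y l) has_sum 0) (grid h \<times> grid h \<times> UNIV)"
proof -
  let ?G = "grid h :: (real ^ 'n) set" and ?U = "UNIV :: (int ^ 'n) set"
  define r where "r x = (\<Sum>\<^sub>\<infinity>(y, l)\<in>?G \<times> ?U. \<mu> x y l)" for x
  have fin: "finite ?G" using finite_grid[OF assms(1)] .
  \<comment> \<open>Exchanging source and target carries the second marginal to the first index,
    where slices can be summed.\<close>
  have swap: "((\<lambda>(x, y, l). f y x l) has_sum s) (?G \<times> ?G \<times> ?U) \<longleftrightarrow>
      ((\<lambda>(x, y, l). f x y l) has_sum s) (?G \<times> ?G \<times> ?U)" for f :: "_ \<Rightarrow> _ \<Rightarrow> _ \<Rightarrow> real" and s
    by (rule has_sum_reindex_bij_witness[where i = "\<lambda>(x, y, l). (y, x, l)" and j = "\<lambda>(x, y, l). (y, x, l)"]) auto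
  have \<mu>: "(\<lambda>(x, y, l). \<mu> x y l) summable_on ?G \<times> ?G \<times> ?U"
    and r: "\<And>x. x \<in> ?G \<Longrightarrow> r x = (\<Sum>\<^sub>\<infinity>(y, l)\<in>?G \<times> ?U. \<mu> y x l)"
    using assms(2) unfolding holonomic_def r_def by (auto simp: summable_on_def)
  have \<mu>': "(\<lambda>(x, y, l). \<mu> y x l) summable_on ?G \<times> ?G \<times> ?U"
    using \<mu> unfolding summable_on_def swap[of \<mu>] .
  have "((\<lambda>(y, l). w x * \<mu> x y l) has_sum w x * r x) (?G \<times> ?U)" if "x \<in> ?G" for x
    using has_sum_cmult_right[OF has_sum_infsum[OF summable_on_SigmaD1[OF \<mu> that]], of "w x"]
    by (simp add: r_def case_prod_unfold)
  from has_sum_Times_finite[OF fin this]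
  have 1: "((\<lambda>(x, y, l). w x * \<mu> x y l) has_sum (\<Sum>x\<in>?G. w x * r x)) (?G \<times> ?G \<times> ?U)"
    by (simp add: case_prod_unfold)
  have "((\<lambda>(y, l). w x * \<mu> y x l) has_sum w x * r x) (?G \<times> ?U)" if "x \<in> ?G" for x
    using has_sum_cmult_right[OF has_sum_infsum[OF summable_on_SigmaD1[OF \<mu>' that]], of "w x"]
    by (simp add: r[OF that] case_prod_unfold)
  from has_sum_Times_finite[OF fin this]
  have "((\<lambda>(x, y, l). w x * \<mu> y x l) has_sum (\<Sum>x\<in>?G. w x * r x)) (?G \<times> ?G \<times> ?U)"
    by (simp add: case_prod_unfold)
  then have 2: "((\<lambda>(x, y, l). w y * \<mu> x y l) has_sum (\<Sum>x\<in>?G. w x * r x)) (?G \<times> ?G \<times> ?U)"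
    by (subst (asm) swap)
  from has_sum_add[OF 2 has_sum_cmult_right[OF 1, of "- 1"]] show ?thesis
    by (simp add: case_prod_unfold algebra_simps)
qed

text \<open>Here \<open>f\<close> need not be summable in the reals. Splitting off the summable
  \<open>k\<close> leaves a nonnegative family, which always has a sum in \<open>ereal\<close>,
  possibly infinite.\<close>

lemma le_infsum_ereal_if_has_sum_le:
  fixes f k :: "'a \<Rightarrow> real"
  assumes "(k has_sum a) A" "\<And>z. z \<in> A \<Longrightarrow> k z \<le> f z"
  shows "ereal a \<le> (\<Sum>\<^sub>\<infinity>z\<in>A. ereal (f z))"
proof -
  have "(\<lambda>z. ereal (f z - k z)) summable_on A"
    using assms(2) by (intro nonneg_summable_on_complete) simp
  then obtain g where g: "((\<lambda>z. ereal (f z - k z)) has_sum g) A" by (auto simp: summable_on_def)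
  have g0: "0 \<le> g" by (rule has_sum_nonneg[OF g]) (use assms(2) in simp)
  have "((\<lambda>z. ereal (k z)) has_sum ereal a) A"
    using assms(1) unfolding has_sum_def by (simp add: sum_ereal[abs_def])
  then have "((\<lambda>z. ereal (k z) + ereal (f z - k z)) has_sum ereal a + g) A"
    \<comment> \<open>Addition in \<open>ereal\<close> is continuous here because the summand
      \<open>ereal a\<close> is finite.\<close>
    using g unfolding has_sum_def sum.distrib by (rule tendsto_add_ereal_general[rotated]) simp
  then have "(\<Sum>\<^sub>\<infinity>z\<in>A. ereal (f z)) = ereal a + g" by (intro infsumI) simp
  then show ?thesis using g0 by (simp add: add_increasing2)
qed

lemma action_lower_bound:
  fixes L :: "real ^ 'n \<Rightarrow> real ^ 'n \<Rightarrow> real"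
  assumes "mesh_size h" "\<mu> \<in> holonomic h"
    and "\<And>x y l. x \<in> grid h \<Longrightarrow> y \<in> grid h \<Longrightarrow> w y + a \<le> w x + L x (velocity \<tau> x y l)"
  shows "ereal a \<le> action L h \<tau> \<mu>"
proof -
  have pos: "\<And>x y l. x \<in> grid h \<Longrightarrow> y \<in> grid h \<Longrightarrow> 0 \<le> \<mu> x y l"
    and one: "((\<lambda>(x, y, l). \<mu> x y l) has_sum 1) (grid h \<times> grid h \<times> UNIV)"
    using assms(2) unfolding holonomic_def by auto
  have "((\<lambda>(x, y, l). (a + (w y - w x)) * \<mu> x y l) has_sum a) (grid h \<times> grid h \<times> UNIV)"
    using has_sum_add[OF has_sum_cmult_right[OF one, of a] has_sum_potential_difference[OF assms(1,2), of w]]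
    by (simp add: case_prod_unfold algebra_simps)
  then have "ereal a \<le> (\<Sum>\<^sub>\<infinity>z\<in>grid h \<times> grid h \<times> UNIV.
      ereal ((\<lambda>(x, y, l). L x (velocity \<tau> x y l) * \<mu> x y l) z))"
  proof (rule le_infsum_ereal_if_has_sum_le, clarify)
    fix x y :: "real ^ 'n" and l assume "x \<in> grid h" "y \<in> grid h"
    then show "(a + (w y - w x)) * \<mu> x y l \<le> L x (velocity \<tau> x y l) * \<mu> x y l"
      using assms(3)[of x y l] pos by (intro mult_right_mono) auto
  qed
  then show ?thesis by (simp add: action_def case_prod_unfold)
qed

section \<open>Construction of a minimising measure\<close>

lemma action_attained:
  fixes L :: "real ^ 'n \<Rightarrow> real ^ 'n \<Rightarrow> real"
  assumes "mesh_size h"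
    and "\<And>y. y \<in> grid h \<Longrightarrow> \<exists>x\<in>grid h. \<exists>l. w y + a = w x + L x (velocity \<tau> x y l)"
  shows "\<exists>\<mu>\<in>holonomic h. action L h \<tau> \<mu> = ereal a"
proof -
  let ?G = "grid h :: (real ^ 'n) set" and ?U = "UNIV :: (int ^ 'n) set"
  obtain p l where p: "\<And>y. y \<in> ?G \<Longrightarrow> p y \<in> ?G"
    and opt: "\<And>y. y \<in> ?G \<Longrightarrow> w y + a = w (p y) + L (p y) (velocity \<tau> (p y) y (l y))"
    using assms(2) by metis
  have fin: "finite ?G" using finite_grid[OF assms(1)] .
  obtain A where A: "A \<subseteq> ?G" "A \<noteq> {}" "bij_betw p A A"
    using finite_endomap_bij_subset[OF fin grid_nonempty, of p] p by auto
  have fA: "finite A" using A(1) fin finite_subset by blast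
  define n where "n = real (card A)"
  have n: "n > 0" using A(2) fA by (simp add: n_def card_gt_0_iff)
  \<comment> \<open>Mass \<open>1 / n\<close> sits on each optimal transition into a point of
    \<open>A\<close>; bijectivity of \<open>p\<close> on \<open>A\<close> makes both marginals
    uniform on \<open>A\<close>.\<close>
  define \<mu> where "\<mu> x y k = (if y \<in> A \<and> x = p y \<and> k = l y then 1 / n else 0)" for x y k
  have pA: "p y \<in> A" if "y \<in> A" for y using A(3) that by (rule bij_betw_apply)
  define E where "E = (\<lambda>y. (p y, y, l y)) ` A"
  have E: "finite E" "E \<subseteq> ?G \<times> ?G \<times> ?U"
    using fA pA A(1) unfolding E_def by auto
  have sumE: "sum f E = (\<Sum>y\<in>A. f (p y, y, l y))" for f :: "_ \<Rightarrow> 'z::comm_monoid_add"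
    unfolding E_def by (subst sum.reindex) (auto simp: inj_on_def)
  have off: "\<mu> x y k = 0" if "(x, y, k) \<notin> E" for x y k
    using that unfolding \<mu>_def E_def by auto
  have "((\<lambda>(x, y, k). \<mu> x y k) has_sum 1) (?G \<times> ?G \<times> ?U)"
    by (rule has_sum_finite_neutralI[OF E]) (use n in \<open>auto simp: off sumE, auto simp: \<mu>_def n_def\<close>)
  moreover have "(\<Sum>\<^sub>\<infinity>(y, k)\<in>?G \<times> ?U. \<mu> x y k) = (if x \<in> A then 1 / n else 0)" if "x \<in> ?G" for x
  proof (cases "x \<in> A")
    case True
    then obtain z where z: "z \<in> A" "p z = x"
      using A(3) unfolding bij_betw_def by (metis imageE)
    \<comment> \<open>Injectivity of \<open>p\<close> leaves exactly one transition out of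
      \<open>x\<close>; the one into \<open>x\<close> comes from \<open>p x\<close>.\<close>
    have "y \<in> A \<and> x = p y \<and> k = l y \<longleftrightarrow> y = z \<and> k = l z" for y k
      using z A(3) unfolding bij_betw_def inj_on_def by metis
    then have \<mu>x: "\<mu> x y k = (if y = z \<and> k = l z then 1 / n else 0)" for y k
      unfolding \<mu>_def by presburger
    have "((\<lambda>(y, k). \<mu> x y k) has_sum 1 / n) (?G \<times> ?U)"
      by (rule has_sum_finite_neutralI[of "{(z, l z)}"]) (use z(1) A(1) in \<open>auto simp: \<mu>x split: if_splits\<close>)
    then show ?thesis using True by (simp add: infsumI)
  next
    case False
    then have "((\<lambda>(y, k). \<mu> x y k) has_sum 0) (?G \<times> ?U)"
      by (intro has_sum_0) (use pA in \<open>auto simp: \<mu>_def\<close>)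
    then show ?thesis using False by (simp add: infsumI)
  qed
  moreover have "(\<Sum>\<^sub>\<infinity>(y, k)\<in>?G \<times> ?U. \<mu> y x k) = (if x \<in> A then 1 / n else 0)" if "x \<in> ?G" for x
  proof (cases "x \<in> A")
    case True
    have "((\<lambda>(y, k). \<mu> y x k) has_sum 1 / n) (?G \<times> ?U)"
      by (rule has_sum_finite_neutralI[of "{(p x, l x)}"])
        (use True p[OF that] in \<open>auto simp: \<mu>_def split: if_splits\<close>)
    then show ?thesis using True by (simp add: infsumI)
  next
    case False
    then have "((\<lambda>(y, k). \<mu> y x k) has_sum 0) (?G \<times> ?U)"
      by (intro has_sum_0) (auto simp: \<mu>_def)
    then show ?thesis using False by (simp add: infsumI)
  qed
  moreover have "0 \<le> \<mu> x y k" for x y k using n by (simp add: \<mu>_def)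
  ultimately have "\<mu> \<in> holonomic h" unfolding holonomic_def by simp
  moreover have "action L h \<tau> \<mu> = ereal a"
    unfolding action_def
  proof (rule infsumI, rule has_sum_finite_neutralI[OF E])
    \<comment> \<open>Since \<open>p\<close> permutes \<open>A\<close>, the potential cancels from
      the summed optimality equations.\<close>
    have "(\<Sum>y\<in>A. w (p y)) = sum w A" using A(3) by (rule sum.reindex_bij_betw)
    moreover have "(\<Sum>y\<in>A. L (p y) (velocity \<tau> (p y) y (l y))) = (\<Sum>y\<in>A. w y + a - w (p y))"
      using opt A(1) by (intro sum.cong) force+
    ultimately have "(\<Sum>y\<in>A. L (p y) (velocity \<tau> (p y) y (l y))) = n * a"
      by (simp add: sum.distrib sum_subtractf n_def)
    then have "(\<Sum>y\<in>A. L (p y) (velocity \<tau> (p y) y (l y)) * (1 / n)) = a"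
      using n by (simp add: sum_divide_distrib[symmetric])
    then show "ereal a = (\<Sum>(x, y, k)\<in>E. ereal (L x (velocity \<tau> x y k) * \<mu> x y k))"
      by (simp add: sumE \<mu>_def)
  qed (auto simp: off)
  ultimately show ?thesis by blast
qed

section \<open>Identification of the eigenvalue with the minimal action\<close>

text \<open>Stated for an arbitrary eigenpair, so that it also yields uniqueness of the
  eigenvalue.\<close>

lemma additive_eigenvalue_is_min_action:
  fixes L :: "real ^ 'n \<Rightarrow> real ^ 'n \<Rightarrow> real"
  assumes "tonelli_lagrangian L" "mesh_size h" "\<tau> > 0"
    and u: "\<forall>y\<in>grid h. lax_oleinik L h \<tau> u y = u y + \<tau> * a"
  shows "\<exists>\<mu>\<in>holonomic h. action L h \<tau> \<mu> = ereal a"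
    and "\<forall>\<mu>\<in>holonomic h. ereal a \<le> action L h \<tau> \<mu>"
proof -
  \<comment> \<open>The action carries no factor \<tau>, so the potential to use is \<open>u\<close>
    divided by \<tau>.\<close>
  have scale: "u y / \<tau> + a \<le> u x / \<tau> + v \<longleftrightarrow> u y + \<tau> * a \<le> u x + \<tau> * v"
    "u y / \<tau> + a = u x / \<tau> + v \<longleftrightarrow> u y + \<tau> * a = u x + \<tau> * v" for x y v
    using mult_le_cancel_left_pos[OF assms(3), of "u y / \<tau> + a" "u x / \<tau> + v"]
      mult_cancel_left[of \<tau> "u y / \<tau> + a" "u x / \<tau> + v"] assms(3)
    by (simp_all add: distrib_left)
  show "\<exists>\<mu>\<in>holonomic h. action L h \<tau> \<mu> = ereal a"
    using u[unfolded lax_oleinik_eq_iff[OF assms(1-3)]]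
    by (intro action_attained[OF assms(2), where w = "\<lambda>x. u x / \<tau>"]) (simp add: scale)
  show "\<forall>\<mu>\<in>holonomic h. ereal a \<le> action L h \<tau> \<mu>"
    using u[unfolded lax_oleinik_eq_iff[OF assms(1-3)]]
    by (intro ballI action_lower_bound[OF assms(2), where w = "\<lambda>x. u x / \<tau>"]) (simp_all add: scale)
qed

lemma lax_oleinik_eigenvector_exists:
  fixes L :: "real ^ 'n \<Rightarrow> real ^ 'n \<Rightarrow> real"
  assumes "tonelli_lagrangian L" "mesh_size h" "\<tau> > 0"
  obtains a u where "\<forall>y\<in>grid h. lax_oleinik L h \<tau> u y = u y + \<tau> * a"
proof -
  obtain l where l: "\<And>x y k. L x (velocity \<tau> x y (l x y)) \<le> L x (velocity \<tau> x y k)"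
    using lagrangian_min_over_translates[OF assms(1,3)] by metis
  \<comment> \<open>Choosing a best translate for each pair leaves a finite cost matrix.\<close>
  define c where "c x y = \<tau> * L x (velocity \<tau> x y (l x y))" for x y
  have c: "c x y \<le> \<tau> * L x (velocity \<tau> x y k)" for x y k
    using l assms(3) by (simp add: c_def)
  obtain b u where sub: "subsolution (grid h) c b u"
    and sol: "\<And>y. y \<in> grid h \<Longrightarrow> \<exists>x\<in>grid h. u y + b = u x + c x y"
    using additive_eigenvector_exists[OF finite_grid[OF assms(2)] grid_nonempty] by metis
  have "\<forall>y\<in>grid h. lax_oleinik L h \<tau> u y = u y + \<tau> * (b / \<tau>)"
    unfolding lax_oleinik_eq_iff[OF assms]
  proof (intro ballI conjI allI)
    fix y :: "real ^ 'n" assume y: "y \<in> grid h"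
    show "\<exists>x\<in>grid h. \<exists>k. u y + \<tau> * (b / \<tau>) = u x + \<tau> * L x (velocity \<tau> x y k)"
      using sol[OF y] assms(3) unfolding c_def by auto
    fix x :: "real ^ 'n" and k assume "x \<in> grid h"
    from subsolutionD[OF sub this y] c[of x y k] assms(3)
    show "u y + \<tau> * (b / \<tau>) \<le> u x + \<tau> * L x (velocity \<tau> x y k)" by simp
  qed
  then show ?thesis using that by blast
qed

theorem proposition4p4:
  fixes L :: "real ^ 'n \<Rightarrow> real ^ 'n \<Rightarrow> real" and h \<tau> :: real
  assumes "tonelli_lagrangian L" and "mesh_size h" and "\<tau> > 0"
  shows "(\<exists>\<mu>\<in>holonomic h. action L h \<tau> \<mu> = ereal (effective_lagrangian L h \<tau>)) \<and>
         (\<forall>\<mu>\<in>holonomic h. ereal (effective_lagrangian L h \<tau>) \<le> action L h \<tau> \<mu>)"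
proof -
  obtain a u where u: "\<forall>y\<in>grid h. lax_oleinik L h \<tau> u y = u y + \<tau> * a"
    using lax_oleinik_eigenvector_exists[OF assms] by metis
  note min = additive_eigenvalue_is_min_action[OF assms]
  \<comment> \<open>Each eigenvalue is the minimum of the same action; uniqueness is what makes the
    \<open>THE\<close> in \<open>effective_lagrangian\<close> denote \<open>a\<close>.\<close>
  have unique: "b = a" if v: "\<forall>y\<in>grid h. lax_oleinik L h \<tau> v y = v y + \<tau> * b" for b v
  proof (rule antisym)
    show "b \<le> a" using min(1)[OF u] min(2)[OF v] by (metis ereal_less_eq(3))
    show "a \<le> b" using min(1)[OF v] min(2)[OF u] by (metis ereal_less_eq(3))
  qed
  have "effective_lagrangian L h \<tau> = a"
    unfolding effective_lagrangian_def
  proof (rule the_equality)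
    show "\<exists>u. \<forall>y\<in>grid h. lax_oleinik L h \<tau> u y = u y + \<tau> * a" by (rule exI[of _ u]) (rule u)
  qed (erule exE, rule unique)
  then show ?thesis using min[OF u] by simp
qed

end
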